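(* Let $\{Y_j\}$ be a sequence of i.i.d. Bernoulli variables with parameter $b\in(0,1)$. Let $M$ be a random variable with values in $\{0,1,2,\dots\}$, independent of $\{Y_j\}$, with probability generating function $P(s)$ satisfying $$\lim_{s\to 1^-}\frac{-\log P(s)}{(1-s)^\alpha}=\lambda$$ for some constants $\lambda>0$ and $0<\alpha\le 1$. Define $X=\sum_{j=1}^{M}Y_j$ and let $X_1$ and $X_2$ be independent copies of $X$. Then $M$ is identically distributed as $X_1+X_2$ if and only if $M$ is $\alpha$-Poisson and $b^\alpha=\frac12$.
   Context: A random variable is $\alpha$-Poisson if its probability generating function is $\exp\{-\lambda(1-s)^\alpha\}$ with $\lambda>0$, $0<\alpha\le1$ (here with the $\alpha$ of the limit condition). An empty sum is $0$. *)

theory Defs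
  imports "HOL-Probability.Probability"
begin

text \<open>Probability generating function \<open>s \<mapsto> E(s ^ N)\<close> of an \<open>\<nat>\<close>-valued
  random variable; meaningful for \<open>\<bar>s\<bar> \<le> 1\<close>.\<close>

definition pgf :: "'a measure \<Rightarrow> ('a \<Rightarrow> nat) \<Rightarrow> real \<Rightarrow> real" where
  "pgf P N s = (\<integral>\<omega>. s ^ N \<omega> \<partial>P)"

text \<open>The equation is required on the whole real interval where every generating function
  is defined. At \<open>s = 1\<close> it reads \<open>1 = exp 0\<close>, because \<open>0 powr \<alpha> = 0\<close>.\<close>

definition alpha_poisson :: "real \<Rightarrow> 'a measure \<Rightarrow> ('a \<Rightarrow> nat) \<Rightarrow> bool" where
  "alpha_poisson \<alpha> P N \<longleftrightarrow>
     0 < \<alpha> \<and> \<alpha> \<le> 1 \<and> N \<in> measurable P (count_space UNIV) \<and>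
     (\<exists>c>0. \<forall>s\<in>{-1..1}. pgf P N s = exp (- c * (1 - s) powr \<alpha>))"

text \<open>The library's \<open>indep_var\<close> forces both random variables to take values in the same type.
  This is its characterisation \<open>indep_var_eq\<close> with the value types kept apart; for
  equal types the two agree, see below.\<close>

definition indep_rv ::
    "'a measure \<Rightarrow> 'b measure \<Rightarrow> ('a \<Rightarrow> 'b) \<Rightarrow> 'c measure \<Rightarrow> ('a \<Rightarrow> 'c) \<Rightarrow> bool" where
  "indep_rv P S X T Y \<longleftrightarrow>
     X \<in> measurable P S \<and> Y \<in> measurable P T \<and>
     prob_space.indep_set P
       (sigma_sets (space P) {X -` A \<inter> space P | A. A \<in> sets S})
       (sigma_sets (space P) {Y -` A \<inter> space P | A. A \<in> sets T})"

lemma (in prob_space) indep_rv_iff_indep_var: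
  fixes X Y :: "'a \<Rightarrow> 'b"
  shows "indep_rv M S X T Y \<longleftrightarrow> indep_var S X T Y"
  unfolding indep_rv_def indep_var_eq by auto

end

theory Submission
  imports Defs
begin

text \<open>
  Conditioning on \<open>M\<close> gives \<open>pgf P X s = pgf P M (1 - b + b s)\<close>, so with
  \<open>\<phi> t = pgf P M (1 - t)\<close> the distributional identity becomes
  \<open>\<phi> t = \<phi> (b t)\<^sup>2\<close>. Hence \<open>h t = - ln (\<phi> t) / t powr \<alpha>\<close> satisfies
  \<open>h t = 2 b powr \<alpha> * h (b t)\<close>. As \<open>h\<close> has a nonzero limit at \<open>0\<close>, this forces
  \<open>2 b powr \<alpha> = 1\<close>, and then \<open>h t = h (b ^ n t)\<close> for all \<open>n\<close>, so \<open>h\<close> is constant.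
\<close>

section \<open>Generating functions as power series, and uniqueness\<close>

text \<open>Total expectation over the events \<open>N = m\<close>, by dominated convergence along
  the truncations \<open>N < K\<close>. It serves twice: for the power series of a generating
  function, and for conditioning a random sum on its number of summands.\<close>

lemma (in prob_space) expectation_partition_sums:
  fixes g :: "'a \<Rightarrow> real" and N :: "'a \<Rightarrow> nat"
  assumes [measurable]: "g \<in> borel_measurable M" "N \<in> measurable M (count_space UNIV)"
    and bound: "\<And>\<omega>. \<bar>g \<omega>\<bar> \<le> B"
  shows "(\<lambda>m. expectation (\<lambda>\<omega>. g \<omega> * of_bool (N \<omega> = m))) sums expectation g"
proof -
  have int: "integrable M (\<lambda>\<omega>. g \<omega> * of_bool (N \<omega> = m))" for m
  proof (rule integrable_const_bound[where B = B])
    show "AE \<omega> in M. norm (g \<omega> * of_bool (N \<omega> = m)) \<le> B"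
      using bound order_trans[OF abs_ge_zero bound] by (auto simp: of_bool_def)
  qed measurable
  have [measurable]: "(\<lambda>\<omega>. of_bool (N \<omega> < K) :: real) \<in> borel_measurable M" for K
    by (rule measurable_compose[OF assms(2)]) simp
  have "(\<lambda>K. expectation (\<lambda>\<omega>. g \<omega> * of_bool (N \<omega> < K))) \<longlonglongrightarrow> expectation g"
  proof (rule integral_dominated_convergence[where w = "\<lambda>_. B"])
    show "AE \<omega> in M. (\<lambda>K. g \<omega> * of_bool (N \<omega> < K)) \<longlonglongrightarrow> g \<omega>"
    proof (rule AE_I2, rule tendsto_eventually)
      fix \<omega>
      show "\<forall>\<^sub>F K in sequentially. g \<omega> * of_bool (N \<omega> < K) = g \<omega>"
        using eventually_gt_at_top[of "N \<omega>"] by eventually_elim simp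
    qed
    show "AE \<omega> in M. norm (g \<omega> * of_bool (N \<omega> < K)) \<le> B" for K
      using bound order_trans[OF abs_ge_zero bound] by (auto simp: of_bool_def)
  qed auto
  moreover have "expectation (\<lambda>\<omega>. g \<omega> * of_bool (N \<omega> < K)) =
      (\<Sum>m<K. expectation (\<lambda>\<omega>. g \<omega> * of_bool (N \<omega> = m)))" for K
  proof -
    have "g \<omega> * of_bool (N \<omega> < K) = (\<Sum>m<K. g \<omega> * of_bool (N \<omega> = m))" for \<omega>
      by (cases "N \<omega> < K") (simp_all add: sum.remove[of _ "N \<omega>"])
    then have "expectation (\<lambda>\<omega>. g \<omega> * of_bool (N \<omega> < K)) =
        expectation (\<lambda>\<omega>. \<Sum>m<K. g \<omega> * of_bool (N \<omega> = m))"
      by presburger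
    also have "\<dots> = (\<Sum>m<K. expectation (\<lambda>\<omega>. g \<omega> * of_bool (N \<omega> = m)))"
      by (rule Bochner_Integration.integral_sum) (rule int)
    finally show ?thesis .
  qed
  ultimately show ?thesis
    by (simp add: sums_def)
qed

lemma (in prob_space) expectation_of_bool_eq:
  assumes [measurable]: "N \<in> measurable M (count_space (UNIV :: nat set))"
  shows "expectation (\<lambda>\<omega>. of_bool (N \<omega> = m)) = measure (distr M (count_space UNIV) N) {m}"
proof -
  have "expectation (\<lambda>\<omega>. of_bool (N \<omega> = m) :: real) = expectation (indicator (N -` {m} \<inter> space M))"
    by (intro Bochner_Integration.integral_cong) (auto simp: indicator_def)
  then show ?thesis
    by (simp add: measure_distr)
qed

lemma (in prob_space) pgf_sums:
  assumes N[measurable]: "N \<in> measurable M (count_space UNIV)" and s: "\<bar>s\<bar> \<le> 1"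
  shows "(\<lambda>k. measure (distr M (count_space UNIV) N) {k} * s ^ k) sums pgf M N s"
proof -
  have "(\<lambda>m. expectation (\<lambda>\<omega>. s ^ N \<omega> * of_bool (N \<omega> = m))) sums pgf M N s"
    unfolding pgf_def
    by (rule expectation_partition_sums[where B = 1]) (use s in \<open>auto simp: power_abs power_le_one\<close>)
  moreover have "expectation (\<lambda>\<omega>. s ^ N \<omega> * of_bool (N \<omega> = m)) =
      measure (distr M (count_space UNIV) N) {m} * s ^ m" for m
  proof -
    have "(\<lambda>\<omega>. s ^ N \<omega> * of_bool (N \<omega> = m)) = (\<lambda>\<omega>. of_bool (N \<omega> = m) * s ^ m)"
      by auto
    then show ?thesis
      by (simp add: expectation_of_bool_eq)
  qed
  ultimately show ?thesis
    by simp
qed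

text \<open>A nonnegative function with integral 0 vanishes almost everywhere, whereas
  \<open>s ^ N\<close> is positive everywhere. This is what later allows taking logarithms.\<close>

lemma (in prob_space) pgf_pos:
  assumes [measurable]: "N \<in> measurable M (count_space UNIV)" and s: "0 < s" "s \<le> 1"
  shows "0 < pgf M N s"
proof -
  have int: "integrable M (\<lambda>\<omega>. s ^ N \<omega>)"
    by (rule integrable_const_bound[where B = 1]) (use s in \<open>auto simp: power_le_one\<close>)
  have "pgf M N s \<noteq> 0"
    using integral_nonneg_eq_0_iff_AE[OF int] s AE_False by (auto simp: pgf_def)
  moreover have "0 \<le> pgf M N s"
    using s by (auto simp: pgf_def)
  ultimately show ?thesis
    by simp
qed

lemma pgf_cong_distr:
  assumes "N \<in> measurable P (count_space UNIV)" "N' \<in> measurable Q (count_space UNIV)"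
    and "distr P (count_space UNIV) N = distr Q (count_space UNIV) N'"
  shows "pgf P N s = pgf Q N' s"
proof -
  have "pgf P N s = (\<integral>n. s ^ n \<partial>distr P (count_space UNIV) N)"
    using assms(1) by (simp add: pgf_def integral_distr)
  also have "\<dots> = pgf Q N' s"
    using assms(2) by (simp add: assms(3) pgf_def integral_distr)
  finally show ?thesis .
qed

text \<open>Strong induction: once the lower coefficients vanish, dividing by \<open>s ^ n\<close>
  leaves a series with constant term \<open>a n\<close> and sum 0 for all small nonzero
  \<open>s\<close>; letting \<open>s\<close> tend to 0 gives \<open>a n = 0\<close>.\<close>

lemma powser_sums_0_imp_coeff_0:
  fixes a :: "nat \<Rightarrow> real"
  assumes r: "0 < r" and sums: "\<And>s. \<bar>s\<bar> < r \<Longrightarrow> (\<lambda>k. a k * s ^ k) sums 0"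
  shows "a n = 0"
proof (induction n rule: less_induct)
  case (less n)
  have "(\<lambda>k. a (k + n) * s ^ k) sums 0" if "s \<noteq> 0" "norm s < r" for s
  proof -
    have "(\<lambda>k. a (k + n) * s ^ (k + n)) sums (0 - (\<Sum>k<n. a k * s ^ k))"
      using sums_split_initial_segment[OF sums[of s], of n] that by simp
    then have "(\<lambda>k. a (k + n) * s ^ (k + n)) sums 0"
      using less by simp
    from sums_mult2[OF this, of "inverse (s ^ n)"] that show ?thesis
      by (simp add: power_add field_simps)
  qed
  from powser_limit_0_strong[OF r this] have "((\<lambda>_. 0) \<longlongrightarrow> a n) (at (0::real))"
    by simp
  then show ?case
    using LIM_const_eq by metis
qed

text \<open>The differences of the point masses are the coefficients of a power series that vanishes
  on \<open>(-1, 1)\<close>, so the point masses agree, and these determine a measure on a countable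
  space.\<close>

lemma distr_eqI_pgf:
  assumes "prob_space P" "prob_space Q"
    and N: "N \<in> measurable P (count_space UNIV)" and N': "N' \<in> measurable Q (count_space UNIV)"
    and eq: "\<And>s. \<bar>s\<bar> < 1 \<Longrightarrow> pgf P N s = pgf Q N' s"
  shows "distr P (count_space UNIV) N = distr Q (count_space UNIV) N'"
proof (rule measure_eqI_countable[of _ UNIV])
  interpret P: prob_space P by fact
  interpret Q: prob_space Q by fact
  interpret PN: prob_space "distr P (count_space UNIV) N"
    by (rule P.prob_space_distr[OF N])
  interpret QN: prob_space "distr Q (count_space UNIV) N'"
    by (rule Q.prob_space_distr[OF N'])
  fix n :: nat
  let ?a = "\<lambda>k. measure (distr P (count_space UNIV) N) {k} - measure (distr Q (count_space UNIV) N') {k}"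
  have "(\<lambda>k. ?a k * s ^ k) sums 0" if "\<bar>s\<bar> < 1" for s
    using sums_diff[OF P.pgf_sums[OF N, of s] Q.pgf_sums[OF N', of s]] eq[OF that] that
    by (simp add: algebra_simps)
  then have "?a n = 0"
    by (rule powser_sums_0_imp_coeff_0[OF zero_less_one])
  then show "emeasure (distr P (count_space UNIV) N) {n} = emeasure (distr Q (count_space UNIV) N') {n}"
    by (simp add: PN.emeasure_eq_measure QN.emeasure_eq_measure)
qed auto

section \<open>Sums of independent variables and random sums\<close>

lemma (in prob_space) pgf_add:
  assumes indep: "indep_var (count_space UNIV) N1 (count_space UNIV) N2" and s: "\<bar>s\<bar> \<le> 1"
  shows "pgf M (\<lambda>\<omega>. N1 \<omega> + N2 \<omega>) s = pgf M N1 s * pgf M N2 s"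
proof -
  have [measurable]: "N1 \<in> measurable M (count_space UNIV)" "N2 \<in> measurable M (count_space UNIV)"
    using indep_var_rv1[OF indep] indep_var_rv2[OF indep] by auto
  have "indep_var borel ((\<lambda>n. s ^ n) \<circ> N1) borel ((\<lambda>n. s ^ n) \<circ> N2)"
    by (rule indep_var_compose[OF indep]) auto
  moreover have "integrable M (\<lambda>\<omega>. s ^ N \<omega>)" if [measurable]: "N \<in> measurable M (count_space UNIV)" for N
    by (rule integrable_const_bound[where B = 1]) (use s in \<open>auto simp: power_abs power_le_one\<close>)
  ultimately show ?thesis
    using indep_var_lebesgue_integral[of "(\<lambda>n. s ^ n) \<circ> N1" "(\<lambda>n. s ^ n) \<circ> N2"]
    by (simp add: pgf_def power_add comp_def)
qed

text \<open>Preimages under \<open>h \<circ> Y\<close> are preimages under \<open>Y\<close>, so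
  composition only shrinks the generated sigma-algebra. This passes from the whole sequence to a
  partial sum.\<close>

lemma (in prob_space) indep_rv_compose:
  assumes indep: "indep_rv M S X T Y" and h[measurable]: "h \<in> measurable T U"
  shows "indep_rv M S X U (h \<circ> Y)"
proof -
  have Y[measurable]: "Y \<in> measurable M T"
    using indep unfolding indep_rv_def by blast
  have "{(h \<circ> Y) -` A \<inter> space M |A. A \<in> sets U} \<subseteq> {Y -` A \<inter> space M |A. A \<in> sets T}"
  proof safe
    fix A assume "A \<in> sets U"
    then have "h -` A \<inter> space T \<in> sets T"
      by simp
    moreover have "(h \<circ> Y) -` A \<inter> space M = Y -` (h -` A \<inter> space T) \<inter> space M"
      using measurable_space[OF Y] by auto
    ultimately show "\<exists>B. (h \<circ> Y) -` A \<inter> space M = Y -` B \<inter> space M \<and> B \<in> sets T"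
      by blast
  qed
  from sigma_sets_mono'[OF this, of "space M"] indep show ?thesis
    unfolding indep_rv_def indep_set_def
    by (auto elim!: indep_sets_mono_sets split: bool.splits)
qed

lemma (in prob_space) pgf_sum_bernoulli:
  fixes Y :: "nat \<Rightarrow> 'a \<Rightarrow> nat"
  assumes indep: "indep_vars (\<lambda>_. count_space UNIV) Y {1..}"
    and b: "0 \<le> b" "b \<le> 1"
    and bernoulli: "\<And>j. j \<ge> 1 \<Longrightarrow>
          distr M (count_space UNIV) (Y j) = measure_pmf (map_pmf of_bool (bernoulli_pmf b))"
    and s: "\<bar>s\<bar> \<le> 1"
  shows "pgf M (\<lambda>\<omega>. \<Sum>j=1..m. Y j \<omega>) s = (1 - b + b * s) ^ m"
proof -
  have Y[measurable]: "Y j \<in> measurable M (count_space UNIV)" if "j \<ge> 1" for j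
    using indep that unfolding indep_vars_def by auto
  have "indep_vars (\<lambda>_. borel) (\<lambda>j \<omega>. s ^ Y j \<omega>) {1..m}"
    by (rule indep_vars_compose2[OF indep_vars_subset[OF indep]]) auto
  moreover have "integrable M (\<lambda>\<omega>. s ^ Y j \<omega>)" if "j \<in> {1..m}" for j
  proof -
    have [measurable]: "Y j \<in> measurable M (count_space UNIV)"
      using that by (intro Y) auto
    show ?thesis
      by (rule integrable_const_bound[where B = 1]) (use s in \<open>auto simp: power_abs power_le_one\<close>)
  qed
  ultimately have "expectation (\<lambda>\<omega>. \<Prod>j=1..m. s ^ Y j \<omega>) = (\<Prod>j=1..m. expectation (\<lambda>\<omega>. s ^ Y j \<omega>))"
    by (intro indep_vars_lebesgue_integral) auto
  then have "pgf M (\<lambda>\<omega>. \<Sum>j=1..m. Y j \<omega>) s = (\<Prod>j=1..m. expectation (\<lambda>\<omega>. s ^ Y j \<omega>))"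
    by (simp add: pgf_def power_sum)
  also have "\<dots> = (\<Prod>j=1..m. 1 - b + b * s)"
  proof (rule prod.cong)
    fix j assume "j \<in> {1..m}"
    then have j: "j \<ge> 1" by simp
    have "expectation (\<lambda>\<omega>. s ^ Y j \<omega>) = (\<integral>n. s ^ n \<partial>distr M (count_space UNIV) (Y j))"
      using Y[OF j] by (simp add: integral_distr)
    also have "\<dots> = 1 - b + b * s"
      using b by (simp add: bernoulli[OF j] algebra_simps)
    finally show "expectation (\<lambda>\<omega>. s ^ Y j \<omega>) = 1 - b + b * s" .
  qed simp
  finally show ?thesis by simp
qed

text \<open>On the event \<open>N = m\<close> the sum is a partial sum independent of
  \<open>N\<close>, so the event contributes its probability times
  \<open>(1 - b + b * s) ^ m\<close>. Adding over \<open>m\<close> gives the power series of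
  \<open>N\<close> at the new argument.\<close>

lemma (in prob_space) pgf_random_sum_bernoulli:
  fixes Y :: "nat \<Rightarrow> 'a \<Rightarrow> nat"
  assumes indep: "indep_vars (\<lambda>_. count_space UNIV) Y {1..}"
    and b: "0 \<le> b" "b \<le> 1"
    and bernoulli: "\<And>j. j \<ge> 1 \<Longrightarrow>
          distr M (count_space UNIV) (Y j) = measure_pmf (map_pmf of_bool (bernoulli_pmf b))"
    and N_Y: "indep_rv M (count_space UNIV) N
          (PiM {1..} (\<lambda>_. count_space UNIV)) (\<lambda>\<omega>. \<lambda>j\<in>{1..}. Y j \<omega>)"
    and s: "\<bar>s\<bar> \<le> 1"
  shows "(\<lambda>\<omega>. \<Sum>j=1..N \<omega>. Y j \<omega>) \<in> measurable M (count_space UNIV)"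
    and "pgf M (\<lambda>\<omega>. \<Sum>j=1..N \<omega>. Y j \<omega>) s = pgf M N (1 - b + b * s)"
proof -
  have N[measurable]: "N \<in> measurable M (count_space UNIV)"
    using N_Y unfolding indep_rv_def by blast
  have Y: "Y j \<in> measurable M (count_space UNIV)" if "j \<ge> 1" for j
    using indep that unfolding indep_vars_def by auto
  \<comment> \<open>Freezing the upper limit at \<open>m\<close> makes \<open>Z m\<close> a function
    of the sequence alone, hence independent of \<open>N\<close>.\<close>
  define Z where "Z m \<omega> = (\<Sum>j=1..m. Y j \<omega>)" for m \<omega>
  have Z_indep: "indep_var (count_space UNIV) N (count_space UNIV) (Z m)" for m
  proof -
    have "(\<lambda>y. \<Sum>j=1..m. y j) \<in> measurable (PiM {1..} (\<lambda>_. count_space (UNIV :: nat set))) (count_space UNIV)"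
      by (rule measurable_sum_nat) auto
    from indep_rv_compose[OF N_Y this]
    have "indep_rv M (count_space UNIV) N (count_space UNIV) (Z m)"
      by (simp add: comp_def Z_def[abs_def])
    then show ?thesis
      by (simp add: indep_rv_iff_indep_var)
  qed
  then have Z[measurable]: "Z m \<in> measurable M (count_space UNIV)" for m
    by (rule indep_var_rv2)
  show X: "(\<lambda>\<omega>. \<Sum>j=1..N \<omega>. Y j \<omega>) \<in> measurable M (count_space UNIV)"
    using measurable_compose_countable[OF Z N] by (simp add: Z_def)
  note [measurable] = X[folded Z_def]
  let ?r = "1 - b + b * s"
  \<comment> \<open>\<open>?r\<close> is a convex combination of 1 and \<open>s\<close>, so
    \<open>pgf_sums\<close> applies there.\<close>
  have r: "\<bar>?r\<bar> \<le> 1"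
  proof -
    have "b * s \<le> b * 1" "b * (-1) \<le> b * s"
      using b s by (intro mult_left_mono; simp)+
    then show ?thesis
      using b by auto
  qed
  have "(\<lambda>m. expectation (\<lambda>\<omega>. s ^ Z (N \<omega>) \<omega> * of_bool (N \<omega> = m))) sums pgf M (\<lambda>\<omega>. Z (N \<omega>) \<omega>) s"
    unfolding pgf_def
    by (rule expectation_partition_sums[where B = 1]) (use s in \<open>auto simp: power_abs power_le_one\<close>)
  moreover have "expectation (\<lambda>\<omega>. s ^ Z (N \<omega>) \<omega> * of_bool (N \<omega> = m)) =
      measure (distr M (count_space UNIV) N) {m} * ?r ^ m" for m
  proof -
    have "indep_var borel ((\<lambda>n. of_bool (n = m) :: real) \<circ> N) borel ((\<lambda>n. s ^ n) \<circ> Z m)"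
      by (rule indep_var_compose[OF Z_indep]) auto
    moreover have "integrable M (\<lambda>\<omega>. s ^ Z m \<omega>)" "integrable M (\<lambda>\<omega>. of_bool (N \<omega> = m) :: real)"
      by (rule integrable_const_bound[where B = 1], use s in \<open>auto simp: power_abs power_le_one\<close>)+
    ultimately have "expectation (\<lambda>\<omega>. of_bool (N \<omega> = m) * s ^ Z m \<omega>) =
        expectation (\<lambda>\<omega>. of_bool (N \<omega> = m)) * pgf M (Z m) s"
      using indep_var_lebesgue_integral[of "(\<lambda>n. of_bool (n = m) :: real) \<circ> N" "(\<lambda>n. s ^ n) \<circ> Z m"]
      by (simp add: comp_def pgf_def)
    moreover have "(\<lambda>\<omega>. s ^ Z (N \<omega>) \<omega> * of_bool (N \<omega> = m)) = (\<lambda>\<omega>. of_bool (N \<omega> = m) * s ^ Z m \<omega>)"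
      by auto
    ultimately show ?thesis
      using pgf_sum_bernoulli[OF indep b bernoulli s, of m]
      by (simp add: expectation_of_bool_eq Z_def[abs_def])
  qed
  ultimately show "pgf M (\<lambda>\<omega>. \<Sum>j=1..N \<omega>. Y j \<omega>) s = pgf M N ?r"
    using sums_unique2[OF _ pgf_sums[OF N r]] by (simp add: Z_def)
qed

section \<open>The functional equation and its solution\<close>

text \<open>Each application contracts the argument by \<open>b\<close> and doubles the exponent, so
  values far from 0 become powers of values close to 0.\<close>

lemma square_functional_equation_iterate:
  fixes \<phi> :: "real \<Rightarrow> real"
  assumes eq: "\<And>t. 0 \<le> t \<Longrightarrow> t \<le> T \<Longrightarrow> \<phi> t = (\<phi> (b * t))\<^sup>2"
    and b: "0 < b" "b < 1" and t: "0 \<le> t" "t \<le> T"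
  shows "\<phi> t = \<phi> (b ^ n * t) ^ 2 ^ n"
proof (induction n)
  case (Suc n)
  have "b ^ n * t \<le> 1 * t"
    using b t by (intro mult_right_mono power_le_one) auto
  then show ?case
    using eq[of "b ^ n * t"] b t Suc by (simp add: power_mult mult.assoc)
qed simp

text \<open>Iteration drives every argument to 0, where the limit decides. Positivity is assumed on
  \<open>(0, 1)\<close>, where logarithms are taken; the points from 1 up to \<open>T\<close> are
  reached by iteration, without sign information there.\<close>

lemma square_functional_equation_solution:
  fixes \<phi> :: "real \<Rightarrow> real"
  assumes eq: "\<And>t. 0 \<le> t \<Longrightarrow> t \<le> T \<Longrightarrow> \<phi> t = (\<phi> (b * t))\<^sup>2"
    and b: "0 < b" "b < 1"
    and pos: "\<And>t. 0 < t \<Longrightarrow> t < 1 \<Longrightarrow> 0 < \<phi> t" and T: "1 \<le> T" and \<phi>_0: "\<phi> 0 = 1"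
    and c: "c \<noteq> 0" and lim: "((\<lambda>t. - ln (\<phi> t) / t powr \<alpha>) \<longlongrightarrow> c) (at_right 0)"
  shows "b powr \<alpha> = 1 / 2" and "\<And>t. 0 \<le> t \<Longrightarrow> t \<le> T \<Longrightarrow> \<phi> t = exp (- c * t powr \<alpha>)"
proof -
  define h where "h t = - ln (\<phi> t) / t powr \<alpha>" for t
  have b_t: "0 < b * t" "b * t < 1" if "0 < t" "t < 1" for t
    using that b mult_strict_mono[of b 1 t 1] by auto
  \<comment> \<open>Taking logarithms turns the square into the factor 2; rewriting the denominator
    \<open>t powr \<alpha>\<close> as \<open>(b * t) powr \<alpha>\<close> costs the factor
    \<open>b powr \<alpha>\<close>.\<close>
  have h_eq: "h t = 2 * b powr \<alpha> * h (b * t)" if t: "0 < t" "t < 1" for t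
  proof -
    have "ln (\<phi> t) = 2 * ln (\<phi> (b * t))"
      using eq[of t] t T pos[OF b_t[OF t]] by (simp add: ln_realpow)
    then show ?thesis
      using b t by (simp add: h_def powr_mult)
  qed
  have lim_h: "(h \<longlongrightarrow> c) (at_right 0)"
    using lim by (simp add: h_def[abs_def])
  have lim_seq: "(\<lambda>n. h (b ^ n * t)) \<longlonglongrightarrow> c" if "0 < t" for t
  proof (rule filterlim_compose[OF lim_h])
    have "(\<lambda>n. b ^ n * t) \<longlonglongrightarrow> 0 * t"
      using b by (intro tendsto_mult LIMSEQ_power_zero) auto
    then show "filterlim (\<lambda>n. b ^ n * t) (at_right 0) sequentially"
      using b that by (auto simp: filterlim_at)
  qed
  have b_n: "0 < b ^ n * t" "b ^ n * t < 1" if "0 < t" "t < 1" for n t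
    using b_t that b mult_le_less_imp_less[of "b ^ n" 1 t 1] power_le_one[of b n] by auto
  \<comment> \<open>The point \<open>1/2\<close> is an arbitrary element of \<open>(0, 1)\<close>.
    Along its orbit \<open>h\<close> tends to \<open>c\<close> and, by \<open>h_eq\<close>, also to
    \<open>2 * b powr \<alpha> * c\<close>.\<close>
  have "(\<lambda>n. h (b ^ Suc n * (1/2))) \<longlonglongrightarrow> c"
    by (rule LIMSEQ_Suc[OF lim_seq]) simp
  then have "(\<lambda>n. 2 * b powr \<alpha> * h (b ^ Suc n * (1/2))) \<longlonglongrightarrow> 2 * b powr \<alpha> * c"
    by (rule tendsto_mult_left)
  moreover have "2 * b powr \<alpha> * h (b ^ Suc n * (1/2)) = h (b ^ n * (1/2))" for n
    using h_eq[OF b_n, of "1/2" n] by (simp add: mult.assoc)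
  ultimately have "(\<lambda>n. h (b ^ n * (1/2))) \<longlonglongrightarrow> 2 * b powr \<alpha> * c"
    by (simp only:)
  then have "2 * b powr \<alpha> * c = c"
    by (rule LIMSEQ_unique[OF _ lim_seq]) simp
  then show half: "b powr \<alpha> = 1 / 2"
    using c by simp
  have const: "h t = c" if t: "0 < t" "t < 1" for t
  proof -
    \<comment> \<open>The factor \<open>2 * b powr \<alpha>\<close> is now 1, so \<open>h\<close> is
      constant along the orbit and equals its limit.\<close>
    have "h (b ^ n * t) = h t" for n
    proof (induction n)
      case (Suc n)
      then show ?case
        using h_eq[OF b_n[OF t, of n]] by (simp add: half mult.assoc)
    qed simp
    then show ?thesis
      using lim_seq[OF t(1)] by (simp add: LIMSEQ_const_iff)
  qed
  have sol: "\<phi> t = exp (- c * t powr \<alpha>)" if t: "0 < t" "t < 1" for t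
  proof -
    have "ln (\<phi> t) = - c * t powr \<alpha>"
      using const[OF t] t by (simp add: h_def field_simps)
    then show ?thesis
      using pos[OF t] exp_ln by metis
  qed
  fix t assume t: "0 \<le> t" "t \<le> T"
  show "\<phi> t = exp (- c * t powr \<alpha>)"
  proof (cases "t = 0")
    case False
    \<comment> \<open>Since \<open>t\<close> may be 1 or larger, the argument is first contracted
      into \<open>(0, 1)\<close>, where \<open>sol\<close> is available.\<close>
    have "(\<lambda>n. b ^ n * t) \<longlonglongrightarrow> 0 * t"
      using b by (intro tendsto_mult LIMSEQ_power_zero) auto
    then have "\<forall>\<^sub>F n in sequentially. b ^ n * t < 1"
      by (rule order_tendstoD) simp
    then obtain n where n: "b ^ n * t < 1"
      by (auto simp: eventually_sequentially)
    have "\<phi> t = exp (- c * (b ^ n * t) powr \<alpha>) ^ 2 ^ n"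
      using square_functional_equation_iterate[where \<phi> = \<phi>, OF eq b t, of n] sol[OF _ n] t False b by simp
    also have "\<dots> = exp (2 ^ n * (- c * (b ^ n * t) powr \<alpha>))"
      by (simp flip: exp_of_nat_mult)
    \<comment> \<open>By \<open>half\<close>, \<open>(b powr \<alpha>) ^ n\<close> is
      \<open>1 / 2 ^ n\<close>, which cancels the exponent gained by iterating.\<close>
    also have "(b ^ n * t) powr \<alpha> = (b powr \<alpha>) ^ n * t powr \<alpha>"
      using b t by (simp add: powr_mult powr_powr mult.commute flip: powr_realpow)
    also have "2 ^ n * (- c * ((b powr \<alpha>) ^ n * t powr \<alpha>)) = - c * t powr \<alpha>"
      by (simp add: half power_divide)
    finally show ?thesis .
  \<comment> \<open>At \<open>t = 0\<close> the right-hand side is 1 because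
    \<open>0 powr \<alpha> = 0\<close>.\<close>
  qed (simp add: \<phi>_0)
qed

section \<open>Equality in law through the functional equation\<close>

theorem theorem4p4:
  fixes P :: "'a measure" and Q :: "'b measure"
    and Y :: "nat \<Rightarrow> 'a \<Rightarrow> nat" and M X :: "'a \<Rightarrow> nat"
    and X1 X2 :: "'b \<Rightarrow> nat"
    and b \<alpha> c :: real
  assumes P: "prob_space P"
    and b: "0 < b" "b < 1"
    and Y_indep: "prob_space.indep_vars P (\<lambda>_. count_space UNIV) Y {1..}"
    and Y_bernoulli: "\<And>j. j \<ge> 1 \<Longrightarrow>
          distr P (count_space UNIV) (Y j) = measure_pmf (map_pmf of_bool (bernoulli_pmf b))"
    and M_Y_indep: "indep_rv P (count_space UNIV) M
          (PiM {1..} (\<lambda>_. count_space UNIV)) (\<lambda>\<omega>. \<lambda>j\<in>{1..}. Y j \<omega>)"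
    and params: "0 < c" "0 < \<alpha>" "\<alpha> \<le> 1"
    and lim: "((\<lambda>s. - ln (pgf P M s) / (1 - s) powr \<alpha>) \<longlongrightarrow> c) (at_left 1)"
    and X: "\<And>\<omega>. X \<omega> = (\<Sum>j=1..M \<omega>. Y j \<omega>)"
    and Q: "prob_space Q"
    and X12_indep: "prob_space.indep_var Q (count_space UNIV) X1 (count_space UNIV) X2"
    and X1_copy: "distr Q (count_space UNIV) X1 = distr P (count_space UNIV) X"
    and X2_copy: "distr Q (count_space UNIV) X2 = distr P (count_space UNIV) X"
  shows "distr P (count_space UNIV) M = distr Q (count_space UNIV) (\<lambda>\<omega>. X1 \<omega> + X2 \<omega>)
     \<longleftrightarrow> alpha_poisson \<alpha> P M \<and> b powr \<alpha> = 1 / 2"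
proof -
  interpret P: prob_space P by fact
  interpret Q: prob_space Q by fact
  have M: "M \<in> measurable P (count_space UNIV)"
    using M_Y_indep unfolding indep_rv_def by blast
  have X12: "X1 \<in> measurable Q (count_space UNIV)" "X2 \<in> measurable Q (count_space UNIV)"
    using Q.indep_var_rv1[OF X12_indep] Q.indep_var_rv2[OF X12_indep] by auto
  then have X1_plus_X2: "(\<lambda>\<omega>. X1 \<omega> + X2 \<omega>) \<in> measurable Q (count_space UNIV)"
    by measurable
  have X_eq: "X = (\<lambda>\<omega>. \<Sum>j=1..M \<omega>. Y j \<omega>)"
    using X by auto
  note random_sum = P.pgf_random_sum_bernoulli[OF Y_indep less_imp_le[OF b(1)] less_imp_le[OF b(2)]
      Y_bernoulli M_Y_indep, folded X_eq]
  have X_meas: "X \<in> measurable P (count_space UNIV)"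
    \<comment> \<open>Any \<open>s\<close> with \<open>\<bar>s\<bar> \<le> 1\<close> serves here, as
      measurability of \<open>X\<close> does not mention \<open>s\<close>.\<close>
    using random_sum(1)[of 1] by simp
  define \<phi> where "\<phi> t = pgf P M (1 - t)" for t
  \<comment> \<open>The range \<open>[0, 2]\<close> of \<open>t\<close> is the range
    \<open>[-1, 1]\<close> of \<open>1 - t\<close>. As
    \<open>1 - b + b * (1 - t) = 1 - b * t\<close>, the change of argument is a scaling of
    \<open>t\<close> by \<open>b\<close>.\<close>
  have pgf_sum: "pgf Q (\<lambda>\<omega>. X1 \<omega> + X2 \<omega>) (1 - t) = (\<phi> (b * t))\<^sup>2" if "0 \<le> t" "t \<le> 2" for t
  proof -
    have s: "\<bar>1 - t\<bar> \<le> 1"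
      using that by auto
    have "pgf Q X1 (1 - t) = \<phi> (b * t)" "pgf Q X2 (1 - t) = \<phi> (b * t)"
      using pgf_cong_distr[OF X12(1) X_meas X1_copy] pgf_cong_distr[OF X12(2) X_meas X2_copy]
        random_sum(2)[OF _ s] by (simp_all add: \<phi>_def algebra_simps)
    then show ?thesis
      by (simp add: Q.pgf_add[OF X12_indep s] power2_eq_square)
  qed
  show ?thesis
  proof
    assume eq: "distr P (count_space UNIV) M = distr Q (count_space UNIV) (\<lambda>\<omega>. X1 \<omega> + X2 \<omega>)"
    have eq: "\<phi> t = (\<phi> (b * t))\<^sup>2" if "0 \<le> t" "t \<le> 2" for t
      using pgf_cong_distr[OF M X1_plus_X2 eq, of "1 - t"] pgf_sum[OF that] by (simp add: \<phi>_def)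
    have pos: "0 < \<phi> t" if "0 < t" "t < 1" for t
      using P.pgf_pos[OF M, of "1 - t"] that by (simp add: \<phi>_def)
    have \<phi>_0: "\<phi> 0 = 1"
      by (simp add: \<phi>_def pgf_def P.prob_space)
    have lim_\<phi>: "((\<lambda>t. - ln (\<phi> t) / t powr \<alpha>) \<longlongrightarrow> c) (at_right 0)"
    proof -
      \<comment> \<open>The substitution \<open>s = 1 - t\<close> turns the left limit at 1 into a
        right limit at 0.\<close>
      have "filterlim (\<lambda>t::real. 1 - t) (at_left 1) (at_right 0)"
        by (auto simp: filterlim_at eventually_at_filter intro!: tendsto_eq_intros)
      from filterlim_compose[OF lim this] show ?thesis
        by (simp add: \<phi>_def)
    qed
    \<comment> \<open>\<open>T = 2\<close> includes the negative arguments of the generating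
      function, which \<open>alpha_poisson\<close> also covers.\<close>
    note solution = square_functional_equation_solution[where T = 2, OF eq b pos _ \<phi>_0 _ lim_\<phi>]
    have half: "b powr \<alpha> = 1 / 2"
      using solution(1) params by auto
    have "pgf P M s = exp (- c * (1 - s) powr \<alpha>)" if "s \<in> {-1..1}" for s
      using solution(2)[of "1 - s"] params that by (simp add: \<phi>_def)
    then show "alpha_poisson \<alpha> P M \<and> b powr \<alpha> = 1 / 2"
      using half params M by (auto simp: alpha_poisson_def)
  next
    assume *: "alpha_poisson \<alpha> P M \<and> b powr \<alpha> = 1 / 2"
    \<comment> \<open>The constant \<open>d\<close> is not identified with \<open>c\<close>; the
      converse works for whatever constant \<open>alpha_poisson\<close> provides.\<close>
    then obtain d where d: "\<And>s. s \<in> {-1..1} \<Longrightarrow> pgf P M s = exp (- d * (1 - s) powr \<alpha>)"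
      unfolding alpha_poisson_def by blast
    have \<phi>: "\<phi> t = exp (- d * t powr \<alpha>)" if "0 \<le> t" "t \<le> 2" for t
      using d[of "1 - t"] that by (simp add: \<phi>_def)
    show "distr P (count_space UNIV) M = distr Q (count_space UNIV) (\<lambda>\<omega>. X1 \<omega> + X2 \<omega>)"
    proof (rule distr_eqI_pgf[OF P Q M X1_plus_X2])
      fix s :: real assume s: "\<bar>s\<bar> < 1"
      let ?t = "1 - s"
      have t: "0 \<le> ?t" "?t \<le> 2"
        using s by auto
      have bt: "0 \<le> b * ?t" "b * ?t \<le> 2"
        using b t mult_mono[of b 1 ?t 2] by auto
      have "(\<phi> (b * ?t))\<^sup>2 = exp (2 * (- d * (b * ?t) powr \<alpha>))"
        by (simp add: \<phi>[OF bt] flip: exp_double)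
      \<comment> \<open>The factor 2 from squaring cancels against
        \<open>b powr \<alpha> = 1 / 2\<close>.\<close>
      also have "\<dots> = \<phi> ?t"
        using * b t by (simp add: \<phi>[OF t] powr_mult)
      finally show "pgf P M s = pgf Q (\<lambda>\<omega>. X1 \<omega> + X2 \<omega>) s"
        using pgf_sum[OF t] by (simp add: \<phi>_def)
    qed
  qed
qed

end
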